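(* Let $\mathcal P^u\in\mathcal B$ be a basic class and let $x\in{}^*\mathbb N$. If, for every $A\in\mathcal P^u\cap\mathcal C$, $x$ has infinitely many exact factors from ${}^*A$, then $x$ also has infinitely many exact factors which are generators of $\mathcal P^u$.
   Context: Divisibility of ultrafilters. $\mathbb N=\{1,2,3,\dots\}$, $\mathbb P$ is the set of primes, $\beta\mathbb N$ is the set of ultrafilters on $\mathbb N$, with $n\in\mathbb N$ identified with the principal ultrafilter at $n$. For $A\subseteq\mathbb N$ let $A\uparrow=\{n\in\mathbb N:(\exists a\in A)\,a\mid n\}$, and $\mathcal U=\{A\subseteq\mathbb N: A\ne\emptyset,\ A=A\uparrow\}$. For $\mathcal F,\mathcal G\in\beta\mathbb N$: $\mathcal F\,\widetilde{\mid}\,\mathcal G$ iff $\mathcal F\cap\mathcal U\subseteq\mathcal G$; $\mathcal F=_\sim\mathcal G$ iff $\mathcal F\,\widetilde{\mid}\,\mathcal G$ and $\mathcal G\,\widetilde{\mid}\,\mathcal F$. Nonstandard extension. Standing assumption: we work in a fixed nonstandard extension ${}^*$ (of a superstructure over $\mathbb N$) which is $\mathfrak c^+$-saturated and satisfies Henson's isomorphism property (any two elementarily equivalent internally presented structures, for a finite first-order language, are isomorphic). For $x\in{}^*\mathbb N$, $tp(x/\mathbb N)=\{A\subseteq\mathbb N:x\in{}^*A\}\in\beta\mathbb N$; $x\models\mathcal F$ ($x$ is a generator of $\mathcal F$) means $tp(x/\mathbb N)=\mathcal F$. Basic classes. $\overline{\mathbb P}=\{\mathcal P\in\beta\mathbb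 N:\mathbb P\in\mathcal P\}$. For $\mathcal P\in\overline{\mathbb P}$, on pairs $(p,a)$ with $p\models\mathcal P$, $a\in{}^*\mathbb N$, put $(p,a)\approx_{\mathcal P}(q,b)$ iff $tp(p^a/\mathbb N)=_\sim tp(q^b/\mathbb N)$; $\mathcal E_{\mathcal P}$ is the set of $\approx_{\mathcal P}$-classes. For $u\in\mathcal E_{\mathcal P}$ the set $\mathcal P^u=\{tp(p^a/\mathbb N):(p,a)\in u\}$ is called a basic class, and $\mathcal B$ is the set of all basic classes. $p^a$ is a generator of $\mathcal P^u$ if it is a generator of some $\mathcal F\in\mathcal P^u$. For $A\subseteq\mathbb N$, $A\in\mathcal P^u$ means $A\in\mathcal F$ for all $\mathcal F\in\mathcal P^u$. Exact factors. For $x\in{}^*\mathbb N$, $p\in{}^*\mathbb P$, $a\in{}^*\mathbb N$, $p^a$ is an exact factor (exact divisor) of $x$ if $x=p^ax'$ with $p$ not dividing $x'$ in ${}^*\mathbb N$. Convex sets. $\mathbb P^{exp}=\{p^n:p\in\mathbb P,n\in\mathbb N\}$. $A\subseteq\mathbb N$ is convex if $a,b\in A$, $a\mid c$, $c\mid b$ imply $c\in A$. $\mathcal C$ is the family of nonempty convex subsets of $\mathbb P^{exp}$; $\mathcal P^u\cap\mathcal C=\{A\in\mathcal C:A\in\mathcal P^u\}$. *)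

theory Defs
  imports Complex_Main "HOL-Library.Equipollence" "HOL-Computational_Algebra.Primes"
begin

section \<open>Divisibility of ultrafilters\<close>

text \<open>The natural numbers start at 1, so ultrafilters on them are ultrafilters of subsets of
  \<open>Npos\<close>.\<close>

definition Npos :: "nat set" where
  "Npos = {1..}"

definition Primes :: "nat set" where
  "Primes = {p. prime p}"

definition betaN :: "nat set set set" where
  "betaN = {F. F \<subseteq> Pow Npos \<and> Npos \<in> F \<and> {} \<notin> F \<and>
     (\<forall>A\<in>F. \<forall>B\<in>F. A \<inter> B \<in> F) \<and>
     (\<forall>A\<in>F. \<forall>B. A \<subseteq> B \<and> B \<subseteq> Npos \<longrightarrow> B \<in> F) \<and>
     (\<forall>A. A \<subseteq> Npos \<longrightarrow> A \<in> F \<or> Npos - A \<in> F)}"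

definition up :: "nat set \<Rightarrow> nat set" where
  "up A = {n \<in> Npos. \<exists>a\<in>A. a dvd n}"

definition upsets :: "nat set set" where
  "upsets = {A. A \<subseteq> Npos \<and> A \<noteq> {} \<and> A = up A}"

definition uf_dvd :: "nat set set \<Rightarrow> nat set set \<Rightarrow> bool" where
  "uf_dvd F G \<longleftrightarrow> F \<inter> upsets \<subseteq> G"

definition uf_eq :: "nat set set \<Rightarrow> nat set set \<Rightarrow> bool" where
  "uf_eq F G \<longleftrightarrow> uf_dvd F G \<and> uf_dvd G F"

definition Pbar :: "nat set set set" where
  "Pbar = {P \<in> betaN. Primes \<in> P}"

definition Pexp :: "nat set" where
  "Pexp = {p ^ n |p n. p \<in> Primes \<and> n \<in> Npos}"

definition dvd_convex :: "nat set \<Rightarrow> bool" where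
  "dvd_convex A \<longleftrightarrow> (\<forall>a\<in>A. \<forall>b\<in>A. \<forall>c\<in>Npos. a dvd c \<and> c dvd b \<longrightarrow> c \<in> A)"

definition convex_family :: "nat set set" where
  "convex_family = {A. A \<subseteq> Pexp \<and> A \<noteq> {} \<and> dvd_convex A}"


section \<open>Superstructures\<close>

text \<open>HOL has no universe of sets, so a superstructure over a set of atoms is given by a type
  with a membership relation. The axioms in \<open>superstructure\<close> determine it up to isomorphism:
  every object is an atom or a set, sets are extensional, every object occurs at a finite
  level, where \<open>V\<^sub>0\<close> consists of the atoms and
  \<open>V\<^sub>n\<^sub>+\<^sub>1 = V\<^sub>n \<union> Pow V\<^sub>n\<close>, and every (external) subset of a level is
  an object.\<close>

record 'v universe =
  mem :: "'v \<Rightarrow> 'v \<Rightarrow> bool"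
  atoms :: "'v set"

definition ext :: "'v universe \<Rightarrow> 'v \<Rightarrow> 'v set" where
  "ext V x = {y. mem V y x}"

primrec level :: "'v universe \<Rightarrow> nat \<Rightarrow> 'v set" where
  "level V 0 = atoms V"
| "level V (Suc n) = level V n \<union> {x. x \<notin> atoms V \<and> ext V x \<subseteq> level V n}"

definition superstructure :: "'v universe \<Rightarrow> bool" where
  "superstructure V \<longleftrightarrow>
     (\<forall>x\<in>atoms V. ext V x = {}) \<and>
     (\<forall>x y. x \<notin> atoms V \<and> y \<notin> atoms V \<and> ext V x = ext V y \<longrightarrow> x = y) \<and>
     (\<forall>x. \<exists>n. x \<in> level V n) \<and>
     (\<forall>n S. S \<subseteq> level V n \<longrightarrow> (\<exists>x. x \<notin> atoms V \<and> ext V x = S))"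

definition set_of :: "'v universe \<Rightarrow> 'v set \<Rightarrow> 'v" where
  "set_of V S = (THE x. x \<notin> atoms V \<and> ext V x = S)"

text \<open>Kuratowski pairs, iterated to tuples.\<close>

definition pair :: "'v universe \<Rightarrow> 'v \<Rightarrow> 'v \<Rightarrow> 'v" where
  "pair V x y = set_of V {set_of V {x}, set_of V {x, y}}"

fun tuple :: "'v universe \<Rightarrow> 'v list \<Rightarrow> 'v" where
  "tuple V [] = set_of V {}"
| "tuple V [x] = x"
| "tuple V (x # y # zs) = pair V x (tuple V (y # zs))"


section \<open>Bounded formulas of set theory\<close>

text \<open>Variables are natural numbers; \<open>BEx i j \<phi>\<close> is \<open>\<exists>v\<^sub>i \<in> v\<^sub>j. \<phi>\<close>, where the bound
  \<open>v\<^sub>j\<close> is evaluated outside the scope of the quantifier, also for \<open>i = j\<close>.\<close>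

datatype bformula =
    BEq nat nat
  | BMem nat nat
  | BNot bformula
  | BAnd bformula bformula
  | BEx nat nat bformula

primrec bsat :: "'v universe \<Rightarrow> (nat \<Rightarrow> 'v) \<Rightarrow> bformula \<Rightarrow> bool" where
  "bsat V e (BEq i j) \<longleftrightarrow> e i = e j"
| "bsat V e (BMem i j) \<longleftrightarrow> mem V (e i) (e j)"
| "bsat V e (BNot \<phi>) \<longleftrightarrow> \<not> bsat V e \<phi>"
| "bsat V e (BAnd \<phi> \<psi>) \<longleftrightarrow> bsat V e \<phi> \<and> bsat V e \<psi>"
| "bsat V e (BEx i j \<phi>) \<longleftrightarrow> (\<exists>x. mem V x (e j) \<and> bsat V (e(i := x)) \<phi>)"


section \<open>Nonstandard extensions of the superstructure over the natural numbers\<close>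

text \<open>\<open>num n\<close> is the atom that represents the positive natural number \<open>n\<close> in the standard
  universe (its value at 0 is irrelevant).\<close>

record ('v, 'w) nonstd =
  std :: "'v universe"
  nst :: "'w universe"
  num :: "nat \<Rightarrow> 'v"
  star :: "'v \<Rightarrow> 'w"

definition star_set :: "('v, 'w) nonstd \<Rightarrow> nat set \<Rightarrow> 'w set" where
  "star_set E A = ext (nst E) (star E (set_of (std E) (num E ` A)))"

definition star_N :: "('v, 'w) nonstd \<Rightarrow> 'w set" where
  "star_N E = star_set E Npos"

definition nonstandard_extension :: "('v, 'w) nonstd \<Rightarrow> bool" where
  "nonstandard_extension E \<longleftrightarrow>
     superstructure (std E) \<and> superstructure (nst E) \<and>
     bij_betw (num E) Npos (atoms (std E)) \<and>
     atoms (nst E) = star_N E \<and>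
     (\<forall>\<phi> e. bsat (std E) e \<phi> \<longleftrightarrow> bsat (nst E) (star E \<circ> e) \<phi>)"

definition internal :: "('v, 'w) nonstd \<Rightarrow> 'w \<Rightarrow> bool" where
  "internal E y \<longleftrightarrow> (\<exists>a. mem (nst E) y (star E a))"

definition internal_set :: "('v, 'w) nonstd \<Rightarrow> 'w set \<Rightarrow> bool" where
  "internal_set E S \<longleftrightarrow> (\<exists>d. internal E d \<and> d \<notin> atoms (nst E) \<and> ext (nst E) d = S)"

text \<open>Families of fewer than \<open>\<cc>\<^sup>+\<close> sets are those of cardinality at most that of the reals.\<close>

definition continuum_plus_saturated :: "('v, 'w) nonstd \<Rightarrow> bool" where
  "continuum_plus_saturated E \<longleftrightarrow>
     (\<forall>\<S>. (\<forall>S\<in>\<S>. internal_set E S) \<and> \<S> \<lesssim> (UNIV :: real set) \<and>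
           (\<forall>\<T>. \<T> \<subseteq> \<S> \<and> finite \<T> \<and> \<T> \<noteq> {} \<longrightarrow> \<Inter>\<T> \<noteq> {})
       \<longrightarrow> \<Inter>\<S> \<noteq> {})"


section \<open>First-order structures and the isomorphism property\<close>

text \<open>A finite language is given by the lists of arities of its function symbols (constants
  being the nullary ones) and of its relation symbols.\<close>

type_synonym language = "nat list \<times> nat list"

datatype fo_term = Var nat | App nat "fo_term list"

datatype fo_formula =
    FEq fo_term fo_term
  | FRel nat "fo_term list"
  | FNot fo_formula
  | FAnd fo_formula fo_formula
  | FEx nat fo_formula

fun wf_term :: "language \<Rightarrow> fo_term \<Rightarrow> bool" where
  "wf_term L (Var i) \<longleftrightarrow> True"
| "wf_term L (App f ts) \<longleftrightarrow>
     f < length (fst L) \<and> length ts = fst L ! f \<and> (\<forall>t\<in>set ts. wf_term L t)"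

primrec wf_formula :: "language \<Rightarrow> fo_formula \<Rightarrow> bool" where
  "wf_formula L (FEq s t) \<longleftrightarrow> wf_term L s \<and> wf_term L t"
| "wf_formula L (FRel r ts) \<longleftrightarrow>
     r < length (snd L) \<and> length ts = snd L ! r \<and> (\<forall>t\<in>set ts. wf_term L t)"
| "wf_formula L (FNot \<phi>) \<longleftrightarrow> wf_formula L \<phi>"
| "wf_formula L (FAnd \<phi> \<psi>) \<longleftrightarrow> wf_formula L \<phi> \<and> wf_formula L \<psi>"
| "wf_formula L (FEx i \<phi>) \<longleftrightarrow> wf_formula L \<phi>"

fun fv_term :: "fo_term \<Rightarrow> nat set" where
  "fv_term (Var i) = {i}"
| "fv_term (App f ts) = (\<Union>t\<in>set ts. fv_term t)"

primrec fv_formula :: "fo_formula \<Rightarrow> nat set" where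
  "fv_formula (FEq s t) = fv_term s \<union> fv_term t"
| "fv_formula (FRel r ts) = (\<Union>t\<in>set ts. fv_term t)"
| "fv_formula (FNot \<phi>) = fv_formula \<phi>"
| "fv_formula (FAnd \<phi> \<psi>) = fv_formula \<phi> \<union> fv_formula \<psi>"
| "fv_formula (FEx i \<phi>) = fv_formula \<phi> - {i}"

record 'a fo_structure =
  dom_of :: "'a set"
  fun_of :: "nat \<Rightarrow> 'a list \<Rightarrow> 'a"
  rel_of :: "nat \<Rightarrow> 'a list \<Rightarrow> bool"

definition tuples :: "'a fo_structure \<Rightarrow> nat \<Rightarrow> 'a list set" where
  "tuples M k = {xs. set xs \<subseteq> dom_of M \<and> length xs = k}"

definition is_structure :: "language \<Rightarrow> 'a fo_structure \<Rightarrow> bool" where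
  "is_structure L M \<longleftrightarrow> dom_of M \<noteq> {} \<and>
     (\<forall>f < length (fst L). \<forall>xs \<in> tuples M (fst L ! f). fun_of M f xs \<in> dom_of M)"

fun eval_term :: "'a fo_structure \<Rightarrow> (nat \<Rightarrow> 'a) \<Rightarrow> fo_term \<Rightarrow> 'a" where
  "eval_term M e (Var i) = e i"
| "eval_term M e (App f ts) = fun_of M f (map (eval_term M e) ts)"

primrec fo_sat :: "'a fo_structure \<Rightarrow> (nat \<Rightarrow> 'a) \<Rightarrow> fo_formula \<Rightarrow> bool" where
  "fo_sat M e (FEq s t) \<longleftrightarrow> eval_term M e s = eval_term M e t"
| "fo_sat M e (FRel r ts) \<longleftrightarrow> rel_of M r (map (eval_term M e) ts)"
| "fo_sat M e (FNot \<phi>) \<longleftrightarrow> \<not> fo_sat M e \<phi>"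
| "fo_sat M e (FAnd \<phi> \<psi>) \<longleftrightarrow> fo_sat M e \<phi> \<and> fo_sat M e \<psi>"
| "fo_sat M e (FEx i \<phi>) \<longleftrightarrow> (\<exists>x\<in>dom_of M. fo_sat M (e(i := x)) \<phi>)"

definition fo_true :: "'a fo_structure \<Rightarrow> fo_formula \<Rightarrow> bool" where
  "fo_true M \<phi> \<longleftrightarrow> (\<forall>e. range e \<subseteq> dom_of M \<longrightarrow> fo_sat M e \<phi>)"

definition elementarily_equivalent ::
    "language \<Rightarrow> 'a fo_structure \<Rightarrow> 'b fo_structure \<Rightarrow> bool" where
  "elementarily_equivalent L M M' \<longleftrightarrow>
     (\<forall>\<phi>. wf_formula L \<phi> \<and> fv_formula \<phi> = {} \<longrightarrow> fo_true M \<phi> = fo_true M' \<phi>)"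

definition isomorphic_structures ::
    "language \<Rightarrow> 'a fo_structure \<Rightarrow> 'b fo_structure \<Rightarrow> bool" where
  "isomorphic_structures L M M' \<longleftrightarrow> (\<exists>h. bij_betw h (dom_of M) (dom_of M') \<and>
     (\<forall>f < length (fst L). \<forall>xs \<in> tuples M (fst L ! f).
        h (fun_of M f xs) = fun_of M' f (map h xs)) \<and>
     (\<forall>r < length (snd L). \<forall>xs \<in> tuples M (snd L ! r).
        rel_of M r xs = rel_of M' r (map h xs)))"

definition internally_presented ::
    "('v, 'w) nonstd \<Rightarrow> language \<Rightarrow> 'w fo_structure \<Rightarrow> bool" where
  "internally_presented E L M \<longleftrightarrow> is_structure L M \<and> internal_set E (dom_of M) \<and>
     (\<forall>f < length (fst L). internal_set E
        {tuple (nst E) (xs @ [fun_of M f xs]) |xs. xs \<in> tuples M (fst L ! f)}) \<and>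
     (\<forall>r < length (snd L). internal_set E
        {tuple (nst E) xs |xs. xs \<in> tuples M (snd L ! r) \<and> rel_of M r xs})"

definition isomorphism_property :: "('v, 'w) nonstd \<Rightarrow> bool" where
  "isomorphism_property E \<longleftrightarrow>
     (\<forall>L M M'. internally_presented E L M \<and> internally_presented E L M' \<and>
        elementarily_equivalent L M M' \<longrightarrow> isomorphic_structures L M M')"


section \<open>Generators, basic classes and exact factors\<close>

definition star_rel :: "('v, 'w) nonstd \<Rightarrow> (nat \<Rightarrow> nat \<Rightarrow> bool) \<Rightarrow> 'w \<Rightarrow> 'w \<Rightarrow> bool" where
  "star_rel E R x y \<longleftrightarrow> tuple (nst E) [x, y] \<in> ext (nst E) (star E (set_of (std E)
     {tuple (std E) [num E m, num E n] |m n. m \<in> Npos \<and> n \<in> Npos \<and> R m n}))"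

definition star_fun :: "('v, 'w) nonstd \<Rightarrow> (nat \<Rightarrow> nat \<Rightarrow> nat) \<Rightarrow> 'w \<Rightarrow> 'w \<Rightarrow> 'w" where
  "star_fun E f x y = (THE z. tuple (nst E) [x, y, z] \<in> ext (nst E) (star E (set_of (std E)
     {tuple (std E) [num E m, num E n, num E (f m n)] |m n. m \<in> Npos \<and> n \<in> Npos})))"

abbreviation star_dvd :: "('v, 'w) nonstd \<Rightarrow> 'w \<Rightarrow> 'w \<Rightarrow> bool" where
  "star_dvd E \<equiv> star_rel E (dvd)"

abbreviation star_mult :: "('v, 'w) nonstd \<Rightarrow> 'w \<Rightarrow> 'w \<Rightarrow> 'w" where
  "star_mult E \<equiv> star_fun E (*)"

abbreviation star_power :: "('v, 'w) nonstd \<Rightarrow> 'w \<Rightarrow> 'w \<Rightarrow> 'w" where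
  "star_power E \<equiv> star_fun E (^)"

definition tp :: "('v, 'w) nonstd \<Rightarrow> 'w \<Rightarrow> nat set set" where
  "tp E x = {A. A \<subseteq> Npos \<and> x \<in> star_set E A}"

definition generates :: "('v, 'w) nonstd \<Rightarrow> 'w \<Rightarrow> nat set set \<Rightarrow> bool" where
  "generates E x F \<longleftrightarrow> x \<in> star_N E \<and> tp E x = F"

definition gen_pairs :: "('v, 'w) nonstd \<Rightarrow> nat set set \<Rightarrow> ('w \<times> 'w) set" where
  "gen_pairs E P = {(p, a). generates E p P \<and> a \<in> star_N E}"

definition pair_equiv :: "('v, 'w) nonstd \<Rightarrow> nat set set \<Rightarrow> (('w \<times> 'w) \<times> ('w \<times> 'w)) set" where
  "pair_equiv E P = {((p, a), (q, b)). (p, a) \<in> gen_pairs E P \<and> (q, b) \<in> gen_pairs E P \<and>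
     uf_eq (tp E (star_power E p a)) (tp E (star_power E q b))}"

definition exponents :: "('v, 'w) nonstd \<Rightarrow> nat set set \<Rightarrow> ('w \<times> 'w) set set" where
  "exponents E P = gen_pairs E P // pair_equiv E P"

text \<open>The class \<open>\<P>\<^sup>u\<close> depends on \<open>\<P>\<close> only through \<open>u \<in> exponents E \<P>\<close>.\<close>

definition basic_class :: "('v, 'w) nonstd \<Rightarrow> ('w \<times> 'w) set \<Rightarrow> nat set set set" where
  "basic_class E u = {tp E (star_power E p a) |p a. (p, a) \<in> u}"

definition basic_classes :: "('v, 'w) nonstd \<Rightarrow> nat set set set set" where
  "basic_classes E = {basic_class E u |P u. P \<in> Pbar \<and> u \<in> exponents E P}"

definition class_generator :: "('v, 'w) nonstd \<Rightarrow> 'w \<Rightarrow> nat set set set \<Rightarrow> bool" where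
  "class_generator E y Q \<longleftrightarrow> (\<exists>F\<in>Q. generates E y F)"

definition in_class :: "nat set \<Rightarrow> nat set set set \<Rightarrow> bool" where
  "in_class A Q \<longleftrightarrow> (\<forall>F\<in>Q. A \<in> F)"

definition exact_factor :: "('v, 'w) nonstd \<Rightarrow> 'w \<Rightarrow> 'w \<Rightarrow> bool" where
  "exact_factor E y x \<longleftrightarrow> (\<exists>p \<in> star_set E Primes. \<exists>a \<in> star_N E. y = star_power E p a \<and>
     (\<exists>x' \<in> star_N E. x = star_mult E y x' \<and> \<not> star_dvd E p x'))"

end

(* For fixed x and a set A of positive integers, the exact factors of x in *A form an internal set
   S A, and S A \<inter> S B = S (A \<inter> B). If x had only a finite set T of exact factors generating the
   basic class Q, the sets S A - T with A convex in Q would be a family of at most continuum many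
   internal sets with the finite intersection property, so by saturation some exact factor q^b of x
   outside T would lie in *A for every convex A in Q. Such a q^b is a generator of Q:
   the convex sets {r^n : r \<in> B prime} determine the type of q, and the convex sets Pexp \<inter> U and Pexp - U
   with U upward closed determine the class of q^b under divisibility. *)

theory Submission
  imports Defs "HOL-Analysis.Abstract_Topology_2"
begin

section \<open>Superstructures and bounded formulas\<close>

locale superstr =
  fixes V :: "'v universe"
  assumes superstructure: "superstructure V"
begin

lemma atom_ext: "x \<in> atoms V \<Longrightarrow> ext V x = {}"
  using superstructure by (simp add: superstructure_def)

lemma extensional:
  "x \<notin> atoms V \<Longrightarrow> y \<notin> atoms V \<Longrightarrow> ext V x = ext V y \<Longrightarrow> x = y"
  using superstructure by (simp add: superstructure_def)

lemma level_mono: "m \<le> n \<Longrightarrow> level V m \<subseteq> level V n"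
  by (induction rule: dec_induct) auto

lemma set_of_unique: "x \<notin> atoms V \<Longrightarrow> ext V x = S \<Longrightarrow> set_of V S = x"
  unfolding set_of_def by (rule the_equality) (auto intro: extensional)

text \<open>The axioms supply codes only for subsets of a single level, so membership in a coded set
  is computed after placing the set in a level.\<close>

lemma
  assumes "S \<subseteq> level V n"
  shows set_of_not_atom: "set_of V S \<notin> atoms V" and ext_set_of: "ext V (set_of V S) = S"
proof -
  from superstructure assms obtain x where x: "x \<notin> atoms V" "ext V x = S"
    unfolding superstructure_def by blast
  show "set_of V S \<notin> atoms V" "ext V (set_of V S) = S"
    using set_of_unique[OF x] x by simp_all
qed

lemma set_of_in_level: "S \<subseteq> level V n \<Longrightarrow> set_of V S \<in> level V (Suc n)"
  using set_of_not_atom ext_set_of by simp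

text \<open>Levels are cumulative, so the larger of two levels absorbs each new element. Finite sets
  therefore have codes without any explicit bound.\<close>

lemma finite_subset_level:
  assumes "finite S" shows "\<exists>n. S \<subseteq> level V n"
  using assms
proof induction
  case (insert x S)
  from superstructure obtain m where m: "x \<in> level V m"
    unfolding superstructure_def by blast
  from insert obtain n where n: "S \<subseteq> level V n" by blast
  have "insert x S \<subseteq> level V (max m n)"
    using m n level_mono[of m "max m n"] level_mono[of n "max m n"] by auto
  then show ?case ..
qed simp

lemma
  assumes "finite S"
  shows ext_set_of_finite: "ext V (set_of V S) = S"
    and set_of_finite_not_atom: "set_of V S \<notin> atoms V"
proof -
  obtain n where n: "S \<subseteq> level V n"
    using finite_subset_level[OF assms] ..
  show "ext V (set_of V S) = S" "set_of V S \<notin> atoms V"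
    by (fact ext_set_of[OF n], fact set_of_not_atom[OF n])
qed

text \<open>Atoms also have the empty extension, so the non-atom clause is what separates them from
  the code of \<open>{}\<close>.\<close>

lemma eq_set_of_iff:
  "finite S \<Longrightarrow> x = set_of V S \<longleftrightarrow> x \<notin> atoms V \<and> ext V x = S"
  using set_of_unique[of x S] ext_set_of_finite[of S] set_of_finite_not_atom[of S] by auto

section \<open>Kuratowski pairs in a superstructure\<close>

lemma pair_inject: "pair V x y = pair V x' y' \<longleftrightarrow> x = x' \<and> y = y'"
proof -
  \<comment> \<open>Finite sets are recovered from their codes as extensions, so
    \<open>set_of\<close> is injective on them; what remains is the usual argument on unordered
    pairs.\<close>
  have inj: "S = T" if "set_of V S = set_of V T" "finite S" "finite T" for S T
  proof -
    have "S = ext V (set_of V S)" by (rule ext_set_of_finite[OF that(2), symmetric])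
    also have "\<dots> = ext V (set_of V T)" by (simp only: that(1))
    also have "\<dots> = T" by (rule ext_set_of_finite[OF that(3)])
    finally show ?thesis .
  qed
  show ?thesis
  proof
    assume "pair V x y = pair V x' y'"
    then have eq: "{set_of V {x}, set_of V {x, y}} = {set_of V {x'}, set_of V {x', y'}}"
      unfolding pair_def by (rule inj) simp_all
    then have "(set_of V {x} = set_of V {x'} \<and> set_of V {x, y} = set_of V {x', y'}) \<or>
        (set_of V {x} = set_of V {x', y'} \<and> set_of V {x, y} = set_of V {x'})"
      by (simp only: doubleton_eq_iff)
    then show "x = x' \<and> y = y'"
    proof (elim disjE conjE)
      assume "set_of V {x} = set_of V {x'}" "set_of V {x, y} = set_of V {x', y'}"
      then have "{x} = {x'}" "{x, y} = {x', y'}"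
        by (simp_all only: inj finite.intros)
      then show ?thesis by (auto simp: doubleton_eq_iff)
    next
      assume "set_of V {x} = set_of V {x', y'}" "set_of V {x, y} = set_of V {x'}"
      then have "{x} = {x', y'}" "{x, y} = {x'}"
        by (simp_all only: inj finite.intros)
      then show ?thesis by auto
    qed
  qed simp
qed

text \<open>One level is spent on the two members of the pair and one on the pair itself.\<close>

lemma pair_in_level:
  assumes "x \<in> level V n" "y \<in> level V n"
  shows "pair V x y \<in> level V (Suc (Suc n))"
proof -
  have "{set_of V {x}, set_of V {x, y}} \<subseteq> level V (Suc n)"
    using set_of_in_level[of "{x}" n] set_of_in_level[of "{x, y}" n] assms by blast
  then show ?thesis
    unfolding pair_def by (rule set_of_in_level)
qed

end

section \<open>Derived connectives and bounded definitions of pairs, triples and graphs\<close>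

definition BAll :: "nat \<Rightarrow> nat \<Rightarrow> bformula \<Rightarrow> bformula" where
  "BAll i j \<phi> = BNot (BEx i j (BNot \<phi>))"

definition BImp :: "bformula \<Rightarrow> bformula \<Rightarrow> bformula" where
  "BImp \<phi> \<psi> = BNot (BAnd \<phi> (BNot \<psi>))"

definition BIff :: "bformula \<Rightarrow> bformula \<Rightarrow> bformula" where
  "BIff \<phi> \<psi> = BAnd (BImp \<phi> \<psi>) (BImp \<psi> \<phi>)"

lemma bsat_BAll [simp]:
  "bsat V e (BAll i j \<phi>) \<longleftrightarrow> (\<forall>x. mem V x (e j) \<longrightarrow> bsat V (e(i := x)) \<phi>)"
  by (simp add: BAll_def)

lemma bsat_BImp [simp]: "bsat V e (BImp \<phi> \<psi>) \<longleftrightarrow> (bsat V e \<phi> \<longrightarrow> bsat V e \<psi>)"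
  by (simp add: BImp_def)

lemma bsat_BIff [simp]: "bsat V e (BIff \<phi> \<psi>) \<longleftrightarrow> (bsat V e \<phi> \<longleftrightarrow> bsat V e \<psi>)"
  by (auto simp: BIff_def)

text \<open>The variables from 90 on are reserved for the quantifiers in the following formulas.\<close>

definition upair_formula :: "nat \<Rightarrow> nat \<Rightarrow> nat \<Rightarrow> bformula" where
  "upair_formula i j u =
     BAnd (BMem i u) (BAnd (BMem j u) (BAll 92 u (BImp (BNot (BEq 92 i)) (BEq 92 j))))"

text \<open>The singleton and the doubleton that make up a Kuratowski pair are members of it, so
  quantifiers bounded by the pair reach them.\<close>

definition pair_formula :: "nat \<Rightarrow> nat \<Rightarrow> nat \<Rightarrow> bformula" where
  "pair_formula i j k = BEx 90 k (BEx 91 k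
     (BAnd (upair_formula i i 90) (BAnd (upair_formula i j 91) (upair_formula 90 91 k))))"

definition rel_formula :: "nat \<Rightarrow> nat \<Rightarrow> nat \<Rightarrow> bformula" where
  "rel_formula i j g = BEx 95 g (pair_formula i j 95)"

text \<open>Kuratowski coding puts the inner pair 97 inside the doubleton member of the triple;
  variable 96 ranges over the members of the triple to give 97 a bound.\<close>

definition triple_formula :: "nat \<Rightarrow> nat \<Rightarrow> nat \<Rightarrow> nat \<Rightarrow> bformula" where
  "triple_formula i j k w =
     BEx 96 w (BEx 97 96 (BAnd (pair_formula j k 97) (pair_formula i 97 w)))"

definition fun_formula :: "nat \<Rightarrow> nat \<Rightarrow> nat \<Rightarrow> nat \<Rightarrow> bformula" where
  "fun_formula i j k g = BEx 95 g (triple_formula i j k 95)"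

context superstr
begin

lemma bsat_upair_formula:
  assumes "i \<noteq> 92" "j \<noteq> 92" "u \<noteq> 92"
  shows "bsat V e (upair_formula i j u) \<longleftrightarrow> e u = set_of V {e i, e j}"
proof -
  have "bsat V e (upair_formula i j u) \<longleftrightarrow>
      mem V (e i) (e u) \<and> mem V (e j) (e u) \<and> (\<forall>x. mem V x (e u) \<longrightarrow> x = e i \<or> x = e j)"
    unfolding upair_formula_def using assms by auto
  also have "\<dots> \<longleftrightarrow> ext V (e u) = {e i, e j}"
    by (auto simp: ext_def)
  \<comment> \<open>An object with a nonempty extension cannot be an atom.\<close>
  also have "\<dots> \<longleftrightarrow> e u \<notin> atoms V \<and> ext V (e u) = {e i, e j}"
    using atom_ext by fastforce
  also have "\<dots> \<longleftrightarrow> e u = set_of V {e i, e j}"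
    by (rule eq_set_of_iff[symmetric]) simp
  finally show ?thesis .
qed

lemma bsat_pair_formula:
  assumes "i \<notin> {90..92}" "j \<notin> {90..92}" "k \<notin> {90..92}"
  shows "bsat V e (pair_formula i j k) \<longleftrightarrow> e k = pair V (e i) (e j)"
proof -
  have ne: "i \<noteq> 90" "i \<noteq> 91" "i \<noteq> 92" "j \<noteq> 90" "j \<noteq> 91" "j \<noteq> 92" "k \<noteq> 90" "k \<noteq> 91" "k \<noteq> 92"
    using assms by auto
  have "mem V u (pair V x y) \<longleftrightarrow> u = set_of V {x} \<or> u = set_of V {x, y}" for u x y
    unfolding pair_def using ext_set_of_finite[of "{set_of V {x}, set_of V {x, y}}"]
    by (auto simp: ext_def)
  then show ?thesis
    unfolding pair_formula_def by (auto simp: ne bsat_upair_formula pair_def)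
qed

lemma bsat_rel_formula:
  assumes "i < 90" "j < 90" "g < 90"
  shows "bsat V e (rel_formula i j g) \<longleftrightarrow> mem V (pair V (e i) (e j)) (e g)"
  unfolding rel_formula_def using assms by (auto simp: bsat_pair_formula)

text \<open>The case \<open>w = 95\<close> serves \<open>fun_formula\<close>, where variable 95
  ranges over the elements of the graph.\<close>

lemma bsat_triple_formula:
  assumes "i < 90" "j < 90" "k < 90" "w < 90 \<or> w = 95"
  shows "bsat V e (triple_formula i j k w) \<longleftrightarrow> e w = pair V (e i) (pair V (e j) (e k))"
proof -
  have *: "mem V s (set_of V {x, s})" "mem V (set_of V {x, s}) (pair V x s)" for x s
    unfolding pair_def
    using ext_set_of_finite[of "{set_of V {x}, set_of V {x, s}}"] ext_set_of_finite[of "{x, s}"]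
    by (auto simp: ext_def)
  have "bsat V e (triple_formula i j k w) \<longleftrightarrow>
      (\<exists>u. mem V u (e w) \<and> (\<exists>s. mem V s u \<and> s = pair V (e j) (e k) \<and> e w = pair V (e i) s))"
    unfolding triple_formula_def using assms by (auto simp: bsat_pair_formula)
  then show ?thesis
    using *[where x = "e i" and s = "pair V (e j) (e k)"] by auto
qed

lemma bsat_fun_formula:
  assumes "i < 90" "j < 90" "k < 90" "g < 90"
  shows "bsat V e (fun_formula i j k g) \<longleftrightarrow> mem V (pair V (e i) (pair V (e j) (e k))) (e g)"
  unfolding fun_formula_def using assms by (auto simp: bsat_triple_formula)

end


section \<open>Transfer\<close>

lemma Npos_power: "m \<in> Npos \<Longrightarrow> n \<in> Npos \<Longrightarrow> m ^ n \<in> Npos"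
  and Npos_mult: "m \<in> Npos \<Longrightarrow> n \<in> Npos \<Longrightarrow> m * n \<in> Npos" for m n :: nat
  by (auto simp: Npos_def)

lemma Primes_subset_Npos: "Primes \<subseteq> Npos"
  by (auto simp: Primes_def Npos_def dest: prime_gt_0_nat)

locale nonstandard =
  fixes E :: "('v, 'w) nonstd"
  assumes nonstandard: "nonstandard_extension E"
begin

sublocale std: superstr "std E"
  using nonstandard by unfold_locales (simp add: nonstandard_extension_def)

sublocale nst: superstr "nst E"
  using nonstandard by unfold_locales (simp add: nonstandard_extension_def)

lemma transfer: "bsat (std E) e \<phi> \<longleftrightarrow> bsat (nst E) (star E \<circ> e) \<phi>"
  using nonstandard by (simp add: nonstandard_extension_def)

lemma inj_num: "inj_on (num E) Npos" and num_in_atoms: "n \<in> Npos \<Longrightarrow> num E n \<in> atoms (std E)"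
  using nonstandard by (auto simp: nonstandard_extension_def bij_betw_def)

lemma num_eq_iff: "m \<in> Npos \<Longrightarrow> n \<in> Npos \<Longrightarrow> num E m = num E n \<longleftrightarrow> m = n"
  using inj_num by (auto simp: inj_on_def)

text \<open>Bounded formulas have no constants. This code and the next three enter them as
  parameters through the environment, and \<open>star\<close> carries them to the nonstandard
  side.\<close>

definition Set :: "nat set \<Rightarrow> 'v" where
  "Set A = set_of (std E) (num E ` A)"

definition Rel :: "(nat \<Rightarrow> nat \<Rightarrow> bool) \<Rightarrow> 'v" where
  "Rel R = set_of (std E) {tuple (std E) [num E m, num E n] |m n. m \<in> Npos \<and> n \<in> Npos \<and> R m n}"

definition Graph :: "(nat \<Rightarrow> nat \<Rightarrow> nat) \<Rightarrow> 'v" where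
  "Graph f = set_of (std E)
     {tuple (std E) [num E m, num E n, num E (f m n)] |m n. m \<in> Npos \<and> n \<in> Npos}"

definition PowN :: 'v where
  "PowN = set_of (std E) (Set ` Pow Npos)"

lemma mem_Set: "A \<subseteq> Npos \<Longrightarrow> mem (std E) v (Set A) \<longleftrightarrow> v \<in> num E ` A"
  unfolding Set_def using std.ext_set_of[of "num E ` A" 0] num_in_atoms
  by (auto simp: ext_def)

lemma mem_PowN: "mem (std E) v PowN \<longleftrightarrow> v \<in> Set ` Pow Npos"
proof -
  have "Set ` Pow Npos \<subseteq> level (std E) (Suc 0)"
    unfolding Set_def by (intro image_subsetI std.set_of_in_level) (auto dest: num_in_atoms)
  from std.ext_set_of[OF this] show ?thesis
    unfolding PowN_def by (auto simp: ext_def)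
qed

lemma mem_Graph_iff:
  assumes f: "\<And>m n. m \<in> Npos \<Longrightarrow> n \<in> Npos \<Longrightarrow> f m n \<in> Npos"
  shows "mem (std E) v (Graph f) \<longleftrightarrow>
    (\<exists>m\<in>Npos. \<exists>n\<in>Npos. v = pair (std E) (num E m) (pair (std E) (num E n) (num E (f m n))))"
proof -
  let ?S = "{tuple (std E) [num E m, num E n, num E (f m n)] |m n. m \<in> Npos \<and> n \<in> Npos}"
  have 0: "num E k \<in> level (std E) 0" if "k \<in> Npos" for k
    using num_in_atoms that by simp
  then have 2: "num E k \<in> level (std E) (Suc (Suc 0))" if "k \<in> Npos" for k
    using that by simp
  \<comment> \<open>Numbers have level 0, the inner pair level 2 and the triple level 4.\<close>
  have "?S \<subseteq> level (std E) (Suc (Suc (Suc (Suc 0))))"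
  proof
    fix v assume "v \<in> ?S"
    then obtain m n where mn: "m \<in> Npos" "n \<in> Npos"
      and v: "v = pair (std E) (num E m) (pair (std E) (num E n) (num E (f m n)))"
      by auto
    show "v \<in> level (std E) (Suc (Suc (Suc (Suc 0))))"
      unfolding v by (intro std.pair_in_level 0 2 f mn)
  qed
  from std.ext_set_of[OF this] have "v \<in> ext (std E) (Graph f) \<longleftrightarrow> v \<in> ?S"
    unfolding Graph_def by simp
  then show ?thesis
    by (auto simp: ext_def)
qed

lemma mem_Graph:
  assumes "\<And>m n. m \<in> Npos \<Longrightarrow> n \<in> Npos \<Longrightarrow> f m n \<in> Npos"
    and "m \<in> Npos" "n \<in> Npos" "k \<in> Npos"
  shows "mem (std E) (pair (std E) (num E m) (pair (std E) (num E n) (num E k))) (Graph f) \<longleftrightarrow>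
    k = f m n"
  using assms by (auto simp: mem_Graph_iff std.pair_inject num_eq_iff)

lemmas bsat_formulas = std.bsat_rel_formula std.bsat_fun_formula std.bsat_triple_formula
  nst.bsat_rel_formula nst.bsat_fun_formula nst.bsat_triple_formula

section \<open>Star extensions of sets of numbers\<close>

lemma in_star_set: "y \<in> star_set E A \<longleftrightarrow> mem (nst E) y (star E (Set A))"
  by (simp add: star_set_def Set_def ext_def)

lemma in_star_N: "y \<in> star_N E \<longleftrightarrow> mem (nst E) y (star E (Set Npos))"
  by (simp add: star_N_def in_star_set)

lemma star_set_Int:
  assumes "A \<subseteq> Npos" "B \<subseteq> Npos"
  shows "star_set E (A \<inter> B) = star_set E A \<inter> star_set E B"
proof -
  \<comment> \<open>Variable \<open>i\<close> denotes the \<open>i\<close>-th list entry. Values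
    beyond the list do not matter, because all other variables of the sentence are bound.\<close>
  let ?e = "(!) [Set (A \<inter> B), Set A, Set B]"
  let ?\<phi> = "BAnd (BAll 10 0 (BAnd (BMem 10 1) (BMem 10 2)))
    (BAll 10 1 (BImp (BMem 10 2) (BMem 10 0)))"
  have AB: "A \<inter> B \<subseteq> Npos"
    using assms by blast
  have "num E ` (A \<inter> B) = num E ` A \<inter> num E ` B"
    by (rule inj_on_image_Int[OF inj_num assms])
  then have "bsat (std E) ?e ?\<phi>"
    by (simp add: mem_Set[OF assms(1)] mem_Set[OF assms(2)] mem_Set[OF AB])
  then have "bsat (nst E) (star E \<circ> ?e) ?\<phi>"
    by (simp only: transfer)
  then show ?thesis
    by (auto simp: in_star_set)
qed

lemma star_set_mono: "A \<subseteq> B \<Longrightarrow> B \<subseteq> Npos \<Longrightarrow> star_set E A \<subseteq> star_set E B"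
  using star_set_Int[of A B] by (auto simp: Int_absorb2)

lemma star_set_subset_star_N: "A \<subseteq> Npos \<Longrightarrow> star_set E A \<subseteq> star_N E"
  unfolding star_N_def by (rule star_set_mono) auto

lemma star_set_Diff:
  assumes "A \<subseteq> Npos" "B \<subseteq> Npos"
  shows "star_set E (A - B) = star_set E A - star_set E B"
proof -
  let ?e = "(!) [Set (A - B), Set A, Set B]"
  let ?\<phi> = "BAnd (BAll 10 0 (BAnd (BMem 10 1) (BNot (BMem 10 2))))
    (BAll 10 1 (BImp (BNot (BMem 10 2)) (BMem 10 0)))"
  have AB: "A - B \<subseteq> Npos"
    using assms by blast
  have "num E ` (A - B) = num E ` A - num E ` B"
    by (rule inj_on_image_set_diff[OF inj_num AB assms(2)])
  then have "bsat (std E) ?e ?\<phi>"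
    by (simp add: mem_Set[OF assms(1)] mem_Set[OF assms(2)] mem_Set[OF AB])
  then have "bsat (nst E) (star E \<circ> ?e) ?\<phi>"
    by (simp only: transfer)
  then show ?thesis
    by (auto simp: in_star_set)
qed

lemma star_set_empty: "star_set E {} = {}"
  using star_set_Diff[of "{}" "{}"] by simp

section \<open>Star extensions of functions\<close>

lemma star_graph:
  assumes f: "\<And>m n. m \<in> Npos \<Longrightarrow> n \<in> Npos \<Longrightarrow> f m n \<in> Npos"
    and "x \<in> star_N E" "y \<in> star_N E"
  shows "\<exists>z\<in>star_N E. \<forall>z'.
    mem (nst E) (pair (nst E) x (pair (nst E) y z')) (star E (Graph f)) \<longleftrightarrow> z' = z"
proof -
  let ?e = "(!) [Set Npos, Graph f]"
  let ?\<phi> = "BAll 10 0 (BAll 11 0 (BEx 12 0 (BAnd (fun_formula 10 11 12 1)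
    (BAll 13 0 (BImp (fun_formula 10 11 13 1) (BEq 13 12))))))"
  \<comment> \<open>\<open>?\<phi>\<close> gives uniqueness only among elements of
    \<open>star_N E\<close>, whereas the description in \<open>star_fun\<close> ranges over all
    objects. \<open>?\<psi>\<close> closes the gap: every element of the graph is a triple of
    numbers.\<close>
  let ?\<psi> = "BAll 9 1 (BEx 10 0 (BEx 11 0 (BEx 12 0 (triple_formula 10 11 12 9))))"
  have "bsat (std E) ?e ?\<phi>"
    using f by (auto simp: bsat_formulas mem_Set mem_Graph)
  then have \<phi>: "bsat (nst E) (star E \<circ> ?e) ?\<phi>"
    by (simp only: transfer)
  have "bsat (std E) ?e ?\<psi>"
    using f by (auto simp: bsat_formulas mem_Set mem_Graph_iff) metis
  then have \<psi>: "bsat (nst E) (star E \<circ> ?e) ?\<psi>"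
    by (simp only: transfer)
  have in_N: "z \<in> star_N E"
    if "mem (nst E) (pair (nst E) x (pair (nst E) y z)) (star E (Graph f))" for z
    using \<psi> that by (fastforce simp: bsat_formulas in_star_N nst.pair_inject)
  from \<phi> assms(2,3) obtain z where z: "z \<in> star_N E"
      "mem (nst E) (pair (nst E) x (pair (nst E) y z)) (star E (Graph f))"
      "\<And>z'. z' \<in> star_N E \<Longrightarrow>
        mem (nst E) (pair (nst E) x (pair (nst E) y z')) (star E (Graph f)) \<Longrightarrow> z' = z"
    by (simp add: bsat_formulas in_star_N) blast
  with in_N show ?thesis
    by blast
qed

lemma
  assumes "\<And>m n. m \<in> Npos \<Longrightarrow> n \<in> Npos \<Longrightarrow> f m n \<in> Npos" "x \<in> star_N E" "y \<in> star_N E"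
  shows star_fun_in_star_N: "star_fun E f x y \<in> star_N E"
    and mem_star_Graph: "mem (nst E) (pair (nst E) x (pair (nst E) y z)) (star E (Graph f)) \<longleftrightarrow>
      z = star_fun E f x y"
proof -
  obtain w where w: "w \<in> star_N E" "\<And>z.
      mem (nst E) (pair (nst E) x (pair (nst E) y z)) (star E (Graph f)) \<longleftrightarrow> z = w"
    using star_graph[of f, OF assms] by blast
  have "star_fun E f x y = w"
    unfolding star_fun_def Graph_def[symmetric] by (simp add: ext_def w(2))
  with w show "star_fun E f x y \<in> star_N E"
    "mem (nst E) (pair (nst E) x (pair (nst E) y z)) (star E (Graph f)) \<longleftrightarrow> z = star_fun E f x y"
    by simp_all
qed

lemma num_mem_image_iff: "n \<in> Npos \<Longrightarrow> A \<subseteq> Npos \<Longrightarrow> num E n \<in> num E ` A \<longleftrightarrow> n \<in> A"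
  by (rule inj_on_image_mem_iff[OF inj_num])

text \<open>Infinite exponents are covered because \<open>AB\<close>, quantified over all primes and
  exponents, is one bounded sentence and transfers as a whole.\<close>

lemma star_prime_power_in_iff:
  assumes "A \<subseteq> Npos" "B \<subseteq> Npos"
    and AB: "\<And>q b. q \<in> Primes \<Longrightarrow> b \<in> Npos \<Longrightarrow> q ^ b \<in> A \<longleftrightarrow> q \<in> B"
    and p: "p \<in> star_set E Primes" and a: "a \<in> star_N E"
  shows "star_power E p a \<in> star_set E A \<longleftrightarrow> p \<in> star_set E B"
proof -
  let ?e = "(!) [Set Npos, Set Primes, Graph (^), Set A, Set B]"
  let ?\<phi> = "BAll 10 1 (BAll 11 0 (BAll 12 0
    (BImp (fun_formula 10 11 12 2) (BIff (BMem 12 3) (BMem 10 4)))))"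
  have std: "v \<in> num E ` A \<longleftrightarrow> num E q \<in> num E ` B"
    if "q \<in> Primes" "b \<in> Npos"
      and v: "mem (std E) (pair (std E) (num E q) (pair (std E) (num E b) v)) (Graph (^))" for q b v
  proof -
    have q: "q \<in> Npos"
      using that(1) Primes_subset_Npos by blast
    have "v = num E (q ^ b)"
      using v q that(2) by (auto simp: mem_Graph_iff[of "(^)", OF Npos_power] std.pair_inject num_eq_iff)
    then show ?thesis
      using AB[OF that(1,2)] num_mem_image_iff[OF Npos_power[OF q that(2)] assms(1)]
        num_mem_image_iff[OF q assms(2)] by simp
  qed
  have "bsat (std E) ?e ?\<phi>"
    by (simp add: bsat_formulas mem_Set assms(1,2) Primes_subset_Npos)
      (intro allI impI, elim imageE, hypsubst, rule std)
  then have "bsat (nst E) (star E \<circ> ?e) ?\<phi>"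
    by (simp only: transfer)
  then have *: "z \<in> star_set E A \<longleftrightarrow> p \<in> star_set E B"
    if "z \<in> star_N E"
      "mem (nst E) (pair (nst E) p (pair (nst E) a z)) (star E (Graph (^)))" for z
    using that p a by (simp add: bsat_formulas in_star_set in_star_N)
  have "p \<in> star_N E"
    using p star_set_subset_star_N[OF Primes_subset_Npos] by blast
  note star_fun_in_star_N[of "(^)", OF Npos_power this a]
    mem_star_Graph[of "(^)", OF Npos_power this a]
  then show ?thesis
    by (intro *) simp_all
qed

section \<open>Internal subsets of the nonstandard numbers\<close>

lemma std_comprehension:
  "\<exists>s. mem (std E) s PowN \<and> (\<forall>z. mem (std E) z (Set Npos) \<longrightarrow> (mem (std E) z s \<longleftrightarrow> \<psi> z))"
proof -
  \<comment> \<open>Every subset of \<open>Npos\<close> has a code in \<open>PowN\<close>, so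
    \<open>\<psi>\<close> may be any predicate. This settles the standard side of each comprehension
    sentence below, and transfer turns it into the internal definition principle.\<close>
  let ?A = "{n \<in> Npos. \<psi> (num E n)}"
  have "mem (std E) (Set ?A) PowN"
    by (auto simp: mem_PowN)
  moreover have "mem (std E) z (Set ?A) \<longleftrightarrow> \<psi> z" if "mem (std E) z (Set Npos)" for z
    using that by (auto simp: mem_Set num_eq_iff)
  ultimately show ?thesis by blast
qed

text \<open>Members of the starred power set are the internal subsets of \<open>star_N E\<close>.
  Unlike \<open>internal_set\<close>, this form can bound a quantifier in a transferred
  sentence.\<close>

definition internal_subsets :: "'w set set" where
  "internal_subsets = {ext (nst E) s |s. mem (nst E) s (star E PowN)}"

lemma internal_subsets_subset: "S \<in> internal_subsets \<Longrightarrow> S \<subseteq> star_N E"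
proof -
  have "bsat (std E) ((!) [Set Npos, PowN]) (BAll 10 1 (BAll 11 10 (BMem 11 0)))"
    by (auto simp: mem_PowN mem_Set) blast
  then have "bsat (nst E) (star E \<circ> (!) [Set Npos, PowN]) (BAll 10 1 (BAll 11 10 (BMem 11 0)))"
    by (simp only: transfer)
  then show "S \<subseteq> star_N E" if "S \<in> internal_subsets"
    using that by (auto simp: internal_subsets_def ext_def in_star_N)
qed

text \<open>Transferred comprehension controls \<open>s\<close> only on \<open>star_N E\<close>;
  that \<open>s\<close> has no members elsewhere comes from
  \<open>internal_subsets_subset\<close>.\<close>

lemma internal_subsetsI:
  assumes "mem (nst E) s (star E PowN)" "S \<subseteq> star_N E"
    and "\<And>z. z \<in> star_N E \<Longrightarrow> mem (nst E) z s \<longleftrightarrow> z \<in> S"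
  shows "S \<in> internal_subsets"
proof -
  have "ext (nst E) s \<in> internal_subsets"
    using assms(1) by (auto simp: internal_subsets_def)
  moreover from internal_subsets_subset[OF this] have "ext (nst E) s = S"
    using assms(2,3) by (auto simp: ext_def)
  ultimately show ?thesis by simp
qed

text \<open>\<open>internal_set\<close> asks for a code that is not an atom, which a nonempty
  extension guarantees.\<close>

lemma internal_set_internal_subsets:
  assumes "S \<in> internal_subsets" "S \<noteq> {}" shows "internal_set E S"
proof -
  obtain s where s: "mem (nst E) s (star E PowN)" "ext (nst E) s = S"
    using assms(1) by (auto simp: internal_subsets_def)
  have "s \<notin> atoms (nst E)"
    using nst.atom_ext[of s] s(2) assms(2) by auto
  with s show ?thesis
    unfolding internal_set_def internal_def by blast
qed

lemma internal_subsets_delete: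
  assumes "S \<in> internal_subsets" "t \<in> star_N E"
  shows "S - {t} \<in> internal_subsets"
proof -
  let ?e = "(!) [Set Npos, PowN]"
  let ?\<phi> = "BAll 10 1 (BAll 11 0 (BEx 12 1 (BAll 13 0
    (BIff (BMem 13 12) (BAnd (BMem 13 10) (BNot (BEq 13 11)))))))"
  have "bsat (std E) ?e ?\<phi>"
    by (simp add: std_comprehension)
  then have "bsat (nst E) (star E \<circ> ?e) ?\<phi>"
    by (simp only: transfer)
  then have *: "\<forall>s. mem (nst E) s (star E PowN) \<longrightarrow> (\<forall>t. t \<in> star_N E \<longrightarrow>
      (\<exists>r. mem (nst E) r (star E PowN) \<and>
        (\<forall>z. z \<in> star_N E \<longrightarrow> (mem (nst E) z r \<longleftrightarrow> mem (nst E) z s \<and> z \<noteq> t))))"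
    by (simp add: in_star_N)
  obtain s where s: "S = ext (nst E) s" "mem (nst E) s (star E PowN)"
    using assms(1) by (auto simp: internal_subsets_def)
  obtain r where r: "mem (nst E) r (star E PowN)"
    "\<And>z. z \<in> star_N E \<Longrightarrow> mem (nst E) z r \<longleftrightarrow> mem (nst E) z s \<and> z \<noteq> t"
    using *[rule_format, OF s(2) assms(2)] by blast
  show ?thesis
  proof (rule internal_subsetsI[OF r(1)])
    show "S - {t} \<subseteq> star_N E"
      using internal_subsets_subset[OF assms(1)] by blast
    show "mem (nst E) z r \<longleftrightarrow> z \<in> S - {t}" if "z \<in> star_N E" for z
      using r(2)[OF that] by (simp add: s(1) ext_def)
  qed
qed

text \<open>Points are removed one at a time. Finitely many generators of a class can thus be
  discarded, although no bounded formula is given for being a generator.\<close>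

lemma internal_subsets_Diff_finite:
  "finite T \<Longrightarrow> T \<subseteq> star_N E \<Longrightarrow> S \<in> internal_subsets \<Longrightarrow> S - T \<in> internal_subsets"
proof (induction rule: finite_induct)
  case (insert t T)
  then have "S - T - {t} \<in> internal_subsets"
    by (simp add: internal_subsets_delete)
  then show ?case
    by (simp only: Diff_insert[of S t T])
qed simp

lemma internal_exact_factors:
  assumes A: "A \<subseteq> Npos" and x: "x \<in> star_N E"
  shows "{y. exact_factor E y x \<and> y \<in> star_set E A} \<in> internal_subsets"
proof -
  let ?e = "(!) [Set Npos, PowN, Set Primes, Graph (^), Graph (*), Rel (dvd), Set A]"
  \<comment> \<open>This spells out \<open>exact_factor\<close>: 12 is the factor, 13 and 14 are its
    prime and exponent, 15 is the cofactor and 10 stands for \<open>x\<close>.\<close>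
  let ?\<psi> = "BAnd (BMem 12 6) (BEx 13 2 (BEx 14 0 (BAnd (fun_formula 13 14 12 3)
    (BEx 15 0 (BAnd (fun_formula 12 15 10 4) (BNot (rel_formula 13 15 5)))))))"
  \<comment> \<open>The nonstandard \<open>x\<close> cannot be a parameter of a standard sentence,
    so it enters as the universally quantified variable 10; 11 is the set being formed.\<close>
  let ?\<phi> = "BAll 10 0 (BEx 11 1 (BAll 12 0 (BIff (BMem 12 11) ?\<psi>)))"
  have "bsat (std E) ?e ?\<phi>"
    by (simp add: bsat_formulas std_comprehension)
  then have "bsat (nst E) (star E \<circ> ?e) ?\<phi>"
    by (simp only: transfer)
  \<comment> \<open>\<open>F\<close> is the literal nonstandard reading of \<open>?\<psi>\<close>,
    with graphs in place of operations; \<open>mem_star_Graph\<close> later turns it into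
    \<open>exact_factor\<close>.\<close>
  moreover define F where "F y z \<longleftrightarrow> z \<in> star_set E A \<and>
    (\<exists>p. p \<in> star_set E Primes \<and> (\<exists>a. a \<in> star_N E \<and>
      mem (nst E) (pair (nst E) p (pair (nst E) a z)) (star E (Graph (^))) \<and>
      (\<exists>x'. x' \<in> star_N E \<and>
        mem (nst E) (pair (nst E) z (pair (nst E) x' y)) (star E (Graph (*))) \<and>
        \<not> mem (nst E) (pair (nst E) p x') (star E (Rel (dvd))))))" for y z
  ultimately have "\<forall>y. y \<in> star_N E \<longrightarrow> (\<exists>s. mem (nst E) s (star E PowN) \<and>
      (\<forall>z. z \<in> star_N E \<longrightarrow> (mem (nst E) z s \<longleftrightarrow> F y z)))"
    by (simp add: bsat_formulas in_star_set in_star_N)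
  with x obtain s where s: "mem (nst E) s (star E PowN)"
    "\<And>z. z \<in> star_N E \<Longrightarrow> mem (nst E) z s \<longleftrightarrow> F x z"
    by blast
  have AN: "star_set E A \<subseteq> star_N E" and PN: "star_set E Primes \<subseteq> star_N E"
    using star_set_subset_star_N A Primes_subset_Npos by blast+
  have "F x z \<longleftrightarrow> z \<in> star_set E A \<and> exact_factor E z x" if z: "z \<in> star_N E" for z
  proof -
    have 1: "mem (nst E) (pair (nst E) p (pair (nst E) a z)) (star E (Graph (^))) \<longleftrightarrow>
        z = star_power E p a" if "p \<in> star_set E Primes" "a \<in> star_N E" for p a
      by (rule mem_star_Graph[of "(^)" p a, OF Npos_power]) (use that PN in blast)+
    have 2: "mem (nst E) (pair (nst E) z (pair (nst E) x' x)) (star E (Graph (*))) \<longleftrightarrow>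
        x = star_mult E z x'" if "x' \<in> star_N E" for x'
      by (rule mem_star_Graph[of "(*)" z x', OF Npos_mult]) (use that z in blast)+
    have 3: "mem (nst E) (pair (nst E) p x') (star E (Rel (dvd))) \<longleftrightarrow> star_dvd E p x'" for p x'
      by (simp add: star_rel_def Rel_def ext_def)
    show ?thesis
      unfolding F_def exact_factor_def 3 Bex_def 
      by (simp add: 2 cong: conj_cong) (simp add: 1 cong: conj_cong)
  qed
  then show ?thesis
    by (intro internal_subsetsI[OF s(1)]) (use s(2) AN in auto)
qed

end


section \<open>Ultrafilters and convex sets\<close>

lemma
  assumes "F \<in> betaN"
  shows betaN_Int: "A \<in> F \<Longrightarrow> B \<in> F \<Longrightarrow> A \<inter> B \<in> F"
    and betaN_empty: "{} \<notin> F"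
    and betaN_Npos: "Npos \<in> F"
    and betaN_subset: "A \<in> F \<Longrightarrow> A \<subseteq> Npos"
    and betaN_Diff: "A \<subseteq> Npos \<Longrightarrow> A \<notin> F \<Longrightarrow> Npos - A \<in> F"
proof -
  from assms have F: "F \<subseteq> Pow Npos" "Npos \<in> F" "{} \<notin> F" "\<forall>A\<in>F. \<forall>B\<in>F. A \<inter> B \<in> F"
    "\<forall>A. A \<subseteq> Npos \<longrightarrow> A \<in> F \<or> Npos - A \<in> F"
    by (simp_all add: betaN_def)
  show "A \<in> F \<Longrightarrow> B \<in> F \<Longrightarrow> A \<inter> B \<in> F" "{} \<notin> F" "Npos \<in> F"
    using F(2-4) by simp_all
  show "A \<in> F \<Longrightarrow> A \<subseteq> Npos"
    using F(1) by auto
  show "A \<subseteq> Npos \<Longrightarrow> A \<notin> F \<Longrightarrow> Npos - A \<in> F"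
    using F(5)[rule_format, of A] by simp
qed

text \<open>Ultrafilters are maximal: a set in \<open>G\<close> but not in \<open>F\<close> would
  have its complement in \<open>F\<close>, hence in \<open>G\<close>.\<close>

lemma betaN_eqI:
  assumes F: "F \<in> betaN" and G: "G \<in> betaN" and FG: "F \<subseteq> G"
  shows "F = G"
proof
  show "G \<subseteq> F"
  proof (rule ccontr)
    assume "\<not> G \<subseteq> F"
    then obtain A where A: "A \<in> G" "A \<notin> F" by blast
    have "Npos - A \<in> F"
      by (rule betaN_Diff[OF F betaN_subset[OF G A(1)] A(2)])
    with FG have "Npos - A \<in> G" ..
    then have "A \<inter> (Npos - A) \<in> G"
      by (rule betaN_Int[OF G A(1)])
    then show False
      using betaN_empty[OF G] by simp
  qed
qed (fact FG)

section \<open>Upward closed sets, prime powers and convexity\<close>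

lemma upsets_upward_closed:
  assumes "U \<in> upsets" "a \<in> U" "a dvd c" "c \<in> Npos"
  shows "c \<in> U"
proof -
  have "c \<in> up U"
    using assms(2-4) by (auto simp: up_def)
  moreover have "U = up U"
    using assms(1) by (simp add: upsets_def)
  ultimately show ?thesis by simp
qed

text \<open>These convex sets test the base of a power. Members \<open>B\<close> of an ultrafilter
  containing \<open>Primes\<close> may contain other numbers, hence the intersection.\<close>

definition prime_powers :: "nat set \<Rightarrow> nat set" where
  "prime_powers B = {p ^ n |p n. p \<in> B \<inter> Primes \<and> n \<in> Npos}"

lemma Pexp_eq: "Pexp = prime_powers Npos"
proof -
  have "Npos \<inter> Primes = Primes"
    using Primes_subset_Npos by blast
  then show ?thesis
    unfolding Pexp_def prime_powers_def by simp
qed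

lemma prime_powers_subset_Pexp: "prime_powers B \<subseteq> Pexp"
  unfolding Pexp_def prime_powers_def by blast

lemma Pexp_subset_Npos: "Pexp \<subseteq> Npos"
  using Primes_subset_Npos Npos_power unfolding Pexp_def by blast

text \<open>The base of a prime power with positive exponent is its only prime divisor.\<close>

lemma prime_powers_iff:
  assumes "q \<in> Primes" "n \<in> Npos"
  shows "q ^ n \<in> prime_powers B \<longleftrightarrow> q \<in> B"
proof
  assume "q ^ n \<in> prime_powers B"
  then obtain p m where pm: "q ^ n = p ^ m" "p \<in> B" "p \<in> Primes" "m \<in> Npos"
    unfolding prime_powers_def by blast
  have "q dvd p ^ m"
    using assms(2) by (auto simp: Npos_def simp flip: pm(1) intro!: dvd_power)
  then have "q = p"
    using assms(1) pm(3) prime_dvd_power primes_dvd_imp_eq unfolding Primes_def by blast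
  with pm(2) show "q \<in> B" by simp
qed (use assms in \<open>auto simp: prime_powers_def\<close>)

lemma dvd_convex_prime_powers: "dvd_convex (prime_powers B)"
  unfolding dvd_convex_def
proof (intro ballI impI)
  fix a b c assume a: "a \<in> prime_powers B" and b: "b \<in> prime_powers B" and dvd: "a dvd c \<and> c dvd b"
  from a obtain p m where p: "prime p" "m \<in> Npos" "a = p ^ m"
    unfolding prime_powers_def Primes_def by blast
  from b obtain q n where q: "q \<in> B" "prime q" "b = q ^ n"
    unfolding prime_powers_def Primes_def by blast
  from dvd obtain i where i: "c = q ^ i"
    using divides_primepow_nat[OF q(2), of c n] q(3) by blast
  \<comment> \<open>The lower end \<open>a\<close> rules out the exponent 0: its prime
    \<open>p\<close> divides \<open>c\<close>, but not 1.\<close>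
  have "p dvd c"
    using p(2,3) dvd by (auto simp: Npos_def intro: dvd_trans[OF dvd_power])
  then have "i \<noteq> 0"
    using i p(1) by (metis not_prime_unit power_0)
  then show "c \<in> prime_powers B"
    using prime_powers_iff[of q i B] q(1,2) i by (simp add: Primes_def Npos_def)
qed

lemma dvd_convex_Int:
  assumes "dvd_convex A" "dvd_convex B" shows "dvd_convex (A \<inter> B)"
  unfolding dvd_convex_def
proof (intro ballI impI)
  fix a b c assume "a \<in> A \<inter> B" "b \<in> A \<inter> B" "c \<in> Npos" "a dvd c \<and> c dvd b"
  then show "c \<in> A \<inter> B"
    using assms[unfolded dvd_convex_def, rule_format, of a b c] by simp
qed

lemma dvd_convex_upset: "U \<in> upsets \<Longrightarrow> dvd_convex U"
  unfolding dvd_convex_def by (intro ballI impI) (elim conjE, rule upsets_upward_closed)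

text \<open>Were \<open>c\<close> in \<open>U\<close>, its multiple \<open>b\<close> would be too.
  With the convexity of \<open>U\<close> itself, convex sets can test membership of \<open>U\<close>
  both ways.\<close>

lemma dvd_convex_Diff_upset:
  assumes "U \<in> upsets" shows "dvd_convex (Npos - U)"
  unfolding dvd_convex_def
proof (intro ballI impI)
  fix a b c assume "b \<in> Npos - U" "c \<in> Npos" "a dvd c \<and> c dvd b"
  then show "c \<in> Npos - U"
    using upsets_upward_closed[OF assms, of c b] by auto
qed


section \<open>Basic classes\<close>

context nonstandard
begin

text \<open>The star map respects intersections, differences and inclusions, so the sets whose star
  contains \<open>x\<close> inherit the ultrafilter laws.\<close>

lemma tp_in_betaN:
  assumes "x \<in> star_N E" shows "tp E x \<in> betaN"
proof -
  have "x \<in> star_set E B" if "x \<in> star_set E A" "A \<subseteq> B" "B \<subseteq> Npos" for A B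
    using that star_set_mono by blast
  then show ?thesis
    unfolding betaN_def tp_def using assms
    by (auto simp: star_set_empty star_set_Int star_set_Diff star_N_def)
qed

lemma star_power_in_star_N:
  "p \<in> star_N E \<Longrightarrow> a \<in> star_N E \<Longrightarrow> star_power E p a \<in> star_N E"
  by (rule star_fun_in_star_N[OF Npos_power])

text \<open>Lets the type of the base \<open>p\<close> be read off from the type of its
  power.\<close>

lemma star_prime_power_in_prime_powers:
  assumes "B \<subseteq> Npos" "p \<in> star_set E Primes" "a \<in> star_N E"
  shows "star_power E p a \<in> star_set E (prime_powers B) \<longleftrightarrow> p \<in> star_set E B"
proof (rule star_prime_power_in_iff)
  show "prime_powers B \<subseteq> Npos"
    using prime_powers_subset_Pexp Pexp_subset_Npos by blast
qed (use assms in \<open>simp_all add: prime_powers_iff\<close>)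

lemma basic_classesE:
  assumes "Q \<in> basic_classes E"
  obtains P p a where "P \<in> Pbar" "(p, a) \<in> gen_pairs E P"
    "Q = basic_class E (pair_equiv E P `` {(p, a)})"
proof -
  obtain P u where P: "P \<in> Pbar" and u: "u \<in> gen_pairs E P // pair_equiv E P"
    and Q: "Q = basic_class E u"
    using assms unfolding basic_classes_def exponents_def by blast
  obtain z where z: "u = pair_equiv E P `` {z}" "z \<in> gen_pairs E P"
    using u by (rule quotientE)
  show thesis
    using that[OF P, of "fst z" "snd z"] z Q by simp
qed

section \<open>Convex sets recognise the generators of a basic class\<close>

lemma class_generatorI:
  assumes Q: "Q \<in> basic_classes E" and q: "q \<in> star_set E Primes" and b: "b \<in> star_N E"
    and mem: "\<And>A. A \<in> convex_family \<Longrightarrow> in_class A Q \<Longrightarrow> star_power E q b \<in> star_set E A"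
  shows "class_generator E (star_power E q b) Q"
proof -
  obtain P p0 a0 where P: "P \<in> Pbar" and p0: "(p0, a0) \<in> gen_pairs E P"
    and Q_eq: "Q = basic_class E (pair_equiv E P `` {(p0, a0)})"
    using Q by (rule basic_classesE)
  \<comment> \<open>The type of a fixed representative; membership in \<open>Q\<close> becomes
    equivalence with \<open>?G\<close> for powers of generators of \<open>P\<close>.\<close>
  let ?G = "tp E (star_power E p0 a0)"
  have Q_iff: "F \<in> Q \<longleftrightarrow> (\<exists>p a. (p, a) \<in> gen_pairs E P \<and> uf_eq ?G (tp E (star_power E p a)) \<and>
      F = tp E (star_power E p a))" for F
    unfolding Q_eq basic_class_def pair_equiv_def using p0 by auto
  have gen: "p \<in> star_set E Primes" "p \<in> star_N E" "a \<in> star_N E" "tp E p = P"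
    if "(p, a) \<in> gen_pairs E P" for p a
    using that P by (auto simp: gen_pairs_def generates_def Pbar_def tp_def)
  have Q_beta: "F \<in> betaN" if "F \<in> Q" for F
    using that gen tp_in_betaN star_power_in_star_N unfolding Q_iff by blast
  have G: "?G \<in> Q"
    unfolding Q_iff using p0 by (auto simp: uf_eq_def uf_dvd_def)
  \<comment> \<open>A set in \<open>Q\<close> belongs to the ultrafilter \<open>?G\<close> and so is
    nonempty; the test sets below need only be convex, consist of prime powers and lie in
    \<open>Q\<close>.\<close>
  have in_star: "star_power E q b \<in> star_set E A"
    if "A \<subseteq> Pexp" "dvd_convex A" "in_class A Q" for A
  proof (rule mem)
    have "A \<noteq> {}"
      using that(3) G betaN_empty[OF Q_beta[OF G]] by (auto simp: in_class_def)
    with that show "A \<in> convex_family"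
      by (simp add: convex_family_def)
  qed (fact that)
  have q_N: "q \<in> star_N E"
    using q star_set_subset_star_N[OF Primes_subset_Npos] by blast
  have prime_powers_in_class: "in_class (prime_powers B) Q" if B: "B \<in> P" for B
    unfolding in_class_def
  proof
    fix F assume "F \<in> Q"
    then obtain p a where pa: "(p, a) \<in> gen_pairs E P" and F: "F = tp E (star_power E p a)"
      unfolding Q_iff by blast
    have "B \<subseteq> Npos" "p \<in> star_set E B"
      using B gen(4)[OF pa] by (auto simp: tp_def)
    then have "star_power E p a \<in> star_set E (prime_powers B)"
      using star_prime_power_in_prime_powers gen[OF pa] by blast
    moreover have "prime_powers B \<subseteq> Npos"
      using prime_powers_subset_Pexp Pexp_subset_Npos by blast
    ultimately show "prime_powers B \<in> F"
      by (simp add: F tp_def)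
  qed
  \<comment> \<open>This inclusion gives equality by maximality of ultrafilters. Each
    \<open>B\<close> in \<open>P\<close> is tested through \<open>prime_powers B\<close>.\<close>
  have "P \<subseteq> tp E q"
  proof (rule subsetI)
    fix B assume B: "B \<in> P"
    then have BN: "B \<subseteq> Npos"
      using P betaN_subset by (auto simp: Pbar_def)
    have "star_power E q b \<in> star_set E (prime_powers B)"
      by (intro in_star prime_powers_subset_Pexp dvd_convex_prime_powers prime_powers_in_class B)
    then show "B \<in> tp E q"
      using star_prime_power_in_prime_powers[OF BN q b] BN by (simp add: tp_def)
  qed
  then have "P = tp E q"
    using P tp_in_betaN[OF q_N] by (intro betaN_eqI) (auto simp: Pbar_def)
  then have qb: "(q, b) \<in> gen_pairs E P"
    using q_N b by (simp add: gen_pairs_def generates_def)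
  have Pexp_in: "Pexp \<in> F" if "F \<in> Q" for F
    using that prime_powers_in_class[of Npos] P
    by (simp add: Pexp_eq in_class_def Pbar_def betaN_Npos)
  \<comment> \<open>Equivalent ultrafilters share their upward closed sets, so whether
    \<open>U\<close> lies in all members of \<open>Q\<close> or in none is decided at
    \<open>?G\<close>.\<close>
  have same: "U \<in> F \<longleftrightarrow> U \<in> ?G" if "U \<in> upsets" "F \<in> Q" for U F
    using that unfolding Q_iff uf_eq_def uf_dvd_def by blast
  have "U \<in> tp E (star_power E q b) \<longleftrightarrow> U \<in> ?G" if U: "U \<in> upsets" for U
  proof
    have UN: "U \<subseteq> Npos"
      using U by (simp add: upsets_def)
    show "U \<in> tp E (star_power E q b)" if "U \<in> ?G"
    proof -
      have "star_power E q b \<in> star_set E (Pexp \<inter> U)"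
      proof (rule in_star)
        show "dvd_convex (Pexp \<inter> U)"
          unfolding Pexp_eq by (intro dvd_convex_Int dvd_convex_prime_powers dvd_convex_upset U)
        show "in_class (Pexp \<inter> U) Q"
          unfolding in_class_def using same[OF U] that Pexp_in betaN_Int[OF Q_beta] by blast
      qed simp
      then show ?thesis
        using star_set_Int[OF Pexp_subset_Npos UN] UN by (simp add: tp_def)
    qed
    show "U \<in> ?G" if "U \<in> tp E (star_power E q b)"
    proof (rule ccontr)
      assume "U \<notin> ?G"
      \<comment> \<open>Since \<open>U\<close> is then in no member of \<open>Q\<close>, its
        complement is in all of them, and the convex complement within \<open>Pexp\<close> forces
        the power out of \<open>star_set E U\<close>.\<close>
      have "star_power E q b \<in> star_set E (Pexp \<inter> (Npos - U))"
      proof (rule in_star)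
        show "dvd_convex (Pexp \<inter> (Npos - U))"
          unfolding Pexp_eq by (intro dvd_convex_Int dvd_convex_prime_powers dvd_convex_Diff_upset U)
        show "in_class (Pexp \<inter> (Npos - U)) Q"
          unfolding in_class_def
        proof
          fix F assume F: "F \<in> Q"
          then have "U \<notin> F"
            using same[OF U F] \<open>U \<notin> ?G\<close> by blast
          then show "Pexp \<inter> (Npos - U) \<in> F"
            by (intro betaN_Int[OF Q_beta[OF F]] Pexp_in[OF F] betaN_Diff[OF Q_beta[OF F]] UN)
        qed
      qed simp
      then show False
        using star_set_Int[OF Pexp_subset_Npos, of "Npos - U"] star_set_Diff[of Npos U] UN that
        by (auto simp: tp_def)
    qed
  qed
  then have "uf_eq ?G (tp E (star_power E q b))"
    unfolding uf_eq_def uf_dvd_def by blast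
  with qb have "tp E (star_power E q b) \<in> Q"
    unfolding Q_iff by blast
  then show ?thesis
    using star_power_in_star_N[OF q_N b] by (auto simp: class_generator_def generates_def)
qed

section \<open>The family of convex sets belonging to a basic class\<close>

lemma
  assumes "Q \<in> basic_classes E"
  shows basic_class_nonempty: "Q \<noteq> {}" and basic_class_subset_betaN: "Q \<subseteq> betaN"
    and in_class_Pexp: "in_class Pexp Q"
proof -
  obtain P p0 a0 where P: "P \<in> Pbar" and p0: "(p0, a0) \<in> gen_pairs E P"
    and Q_eq: "Q = basic_class E (pair_equiv E P `` {(p0, a0)})"
    using assms by (rule basic_classesE)
  have "((p0, a0), (p0, a0)) \<in> pair_equiv E P"
    using p0 by (auto simp: pair_equiv_def uf_eq_def uf_dvd_def)
  then show "Q \<noteq> {}"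
    by (auto simp: Q_eq basic_class_def)
  have F: "F \<in> betaN \<and> Pexp \<in> F" if FQ: "F \<in> Q" for F
  proof -
    obtain p a where "(p, a) \<in> pair_equiv E P `` {(p0, a0)}" and F: "F = tp E (star_power E p a)"
      using FQ unfolding Q_eq basic_class_def by blast
    then have pa: "(p, a) \<in> gen_pairs E P"
      by (simp add: pair_equiv_def)
    from pa have p: "p \<in> star_set E Primes" "p \<in> star_N E" "a \<in> star_N E"
      using P by (auto simp: gen_pairs_def generates_def Pbar_def tp_def)
    then have "star_power E p a \<in> star_set E Pexp"
      using star_prime_power_in_prime_powers[of Npos p a] by (simp add: Pexp_eq star_N_def)
    moreover have "F \<in> betaN"
      unfolding F by (rule tp_in_betaN[OF star_power_in_star_N[OF p(2,3)]])
    ultimately show ?thesis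
      using Pexp_subset_Npos by (simp add: F tp_def)
  qed
  then show "Q \<subseteq> betaN" "in_class Pexp Q"
    by (auto simp: in_class_def)
qed

text \<open>Disjoint convex sets exist, so nonemptiness has to come from \<open>Q\<close>: the
  intersection lies in an ultrafilter.\<close>

lemma convex_family_in_class_Int:
  assumes "Q \<in> basic_classes E"
    and "A \<in> convex_family" "in_class A Q" "B \<in> convex_family" "in_class B Q"
  shows "A \<inter> B \<in> convex_family" "in_class (A \<inter> B) Q"
proof -
  show AB: "in_class (A \<inter> B) Q"
    using assms(3,5) basic_class_subset_betaN[OF assms(1)] betaN_Int
    by (auto simp: in_class_def)
  then have "A \<inter> B \<noteq> {}"
    using basic_class_nonempty[OF assms(1)] basic_class_subset_betaN[OF assms(1)] betaN_empty
    by (fastforce simp: in_class_def)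
  then show "A \<inter> B \<in> convex_family"
    using assms(2,4) dvd_convex_Int by (auto simp: convex_family_def)
qed

lemma convex_family_in_class_Inter:
  assumes "Q \<in> basic_classes E" "finite \<A>" "\<A> \<noteq> {}" "\<A> \<subseteq> {A \<in> convex_family. in_class A Q}"
  shows "\<Inter>\<A> \<in> {A \<in> convex_family. in_class A Q}"
  using assms(2-4)
proof (induction rule: finite_ne_induct)
  case (insert A \<A>)
  then show ?case
    using convex_family_in_class_Int[OF assms(1), of A "\<Inter>\<A>"] by simp
qed simp

end

section \<open>Saturation for exact factors outside a finite set of generators\<close>

theorem corollary4p9:
  fixes E :: "('v, 'w) nonstd" and Q :: "nat set set set" and x :: 'w
  assumes "nonstandard_extension E"
    and "continuum_plus_saturated E"
    and "isomorphism_property E"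
    and "Q \<in> basic_classes E"
    and "x \<in> star_N E"
    and "\<And>A. A \<in> convex_family \<Longrightarrow> in_class A Q \<Longrightarrow>
           infinite {y. exact_factor E y x \<and> y \<in> star_set E A}"
  shows "infinite {y. exact_factor E y x \<and> class_generator E y Q}"
proof
  interpret nonstandard E
    by unfold_locales (fact assms(1))
  let ?T = "{y. exact_factor E y x \<and> class_generator E y Q}"
  let ?K = "{A \<in> convex_family. in_class A Q}"
  define S where "S A = {y. exact_factor E y x \<and> y \<in> star_set E A}" for A
  assume fin: "finite ?T"
  have T: "?T \<subseteq> star_N E"
    using star_set_subset_star_N[OF Primes_subset_Npos]
    by (auto simp: exact_factor_def intro!: star_power_in_star_N)
  have K: "A \<subseteq> Npos" if "A \<in> ?K" for A
    using that Pexp_subset_Npos by (auto simp: convex_family_def)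
  have S_mono: "S A \<subseteq> S B" if "A \<subseteq> B" "B \<in> ?K" for A B
    using star_set_mono[OF that(1) K[OF that(2)]] by (auto simp: S_def)
  have ne: "S A - ?T \<noteq> {}" if "A \<in> ?K" for A
    using assms(6)[of A] that fin finite_subset[of "S A" ?T] by (auto simp: S_def)
  let ?\<S> = "(\<lambda>A. S A - ?T) ` ?K"
  have "\<forall>X\<in>?\<S>. internal_set E X"
  proof
    fix X assume "X \<in> ?\<S>"
    then obtain A where A: "A \<in> ?K" and X: "X = S A - ?T" by blast
    have "S A \<in> internal_subsets"
      unfolding S_def by (rule internal_exact_factors[OF K[OF A] assms(5)])
    then show "internal_set E X"
      unfolding X by (intro internal_set_internal_subsets internal_subsets_Diff_finite fin T ne A)
  qed
  \<comment> \<open>The index family consists of sets of naturals, and there are continuum many of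
    those.\<close>
  moreover have "?\<S> \<lesssim> (UNIV :: real set)"
    by (rule lepoll_trans[OF image_lepoll]) (rule lepoll_trans[OF subset_imp_lepoll[OF subset_UNIV]
      eqpoll_imp_lepoll[OF nat_sets_eqpoll_reals]])
  moreover have "\<Inter>\<T> \<noteq> {}" if \<T>: "\<T> \<subseteq> ?\<S>" "finite \<T>" "\<T> \<noteq> {}" for \<T>
  proof -
    obtain \<A> where \<A>: "\<A> \<subseteq> ?K" "finite \<A>" "\<T> = (\<lambda>A. S A - ?T) ` \<A>"
      using finite_subset_image[OF \<T>(2,1)] by blast
    \<comment> \<open>Finitely many conditions reduce to one: the intersection of the indices is
      again a convex set in \<open>Q\<close>, and \<open>S\<close> is monotone.\<close>
    have "\<Inter>\<A> \<in> ?K"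
      using \<A> \<T>(3) by (intro convex_family_in_class_Inter[OF assms(4)]) auto
    from ne[OF this] obtain y where y: "y \<in> S (\<Inter>\<A>)" "y \<notin> ?T" by blast
    have "y \<in> S A" if "A \<in> \<A>" for A
      using S_mono[of "\<Inter>\<A>" A] y(1) that \<A>(1) by blast
    with y(2) have "y \<in> \<Inter>\<T>"
      unfolding \<A>(3) by blast
    then show ?thesis by blast
  qed
  ultimately have "\<Inter>?\<S> \<noteq> {}"
    by (intro assms(2)[unfolded continuum_plus_saturated_def, rule_format]) auto
  then obtain y where "y \<in> \<Inter>?\<S>"
    by auto
  then have y: "y \<in> S A - ?T" if "A \<in> ?K" for A
    using that by blast
  \<comment> \<open>\<open>Pexp\<close> is itself an index, so \<open>?K\<close> is nonempty; this
    instance makes \<open>y\<close> an exact factor outside \<open>?T\<close>.\<close>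
  have "Pexp \<noteq> {}"
    using in_class_Pexp[OF assms(4)] basic_class_nonempty[OF assms(4)]
      basic_class_subset_betaN[OF assms(4)] betaN_empty by (fastforce simp: in_class_def)
  then have "Pexp \<in> ?K"
    using in_class_Pexp[OF assms(4)] dvd_convex_prime_powers[of Npos]
    by (simp add: convex_family_def Pexp_eq)
  from y[OF this] have ex: "exact_factor E y x" and not_T: "y \<notin> ?T"
    by (auto simp: S_def)
  obtain q b where q: "q \<in> star_set E Primes" and b: "b \<in> star_N E" and y_eq: "y = star_power E q b"
    using ex by (auto simp: exact_factor_def)
  have "class_generator E y Q"
    unfolding y_eq
  proof (rule class_generatorI[OF assms(4) q b])
    fix A assume "A \<in> convex_family" "in_class A Q"
    then show "star_power E q b \<in> star_set E A"
      using y[of A] by (simp add: S_def y_eq)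
  qed
  with ex not_T show False by blast
qed

end
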